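(* Let $m$ be a positive integer. (Even case.) Let $\lambda=(\lambda_1\ge\cdots\ge\lambda_{2m}\ge0)$ be a partition and $y_i=2m+\lambda_i-i$ for $i=1,\ldots,2m$. Then \[ \int_{[0,1]^m} s_\lambda(x_1,x_1,x_2,x_2,\ldots,x_m,x_m) \prod_{1\le i<j\le m}(x_i-x_j)^4 \, \mathrm{d}x_1\cdots\mathrm{d}x_m=m!\prod_{1\le i<j\le 2m}\frac{y_i-y_j}{y_i+y_j}.\] (Odd case.) Let $\lambda=(\lambda_1\ge\cdots\ge\lambda_{2m+1}\ge0)$ be a partition and $y_i=2m+1+\lambda_i-i$ for $i=1,\ldots,2m+1$. Then \[\int_{[0,1]^m} s_\lambda(x_1,x_1,\ldots,x_m,x_m,1) \prod_{1\le i<j\le m}(x_i-x_j)^4 \prod_{1\le i\le m}(1-x_i)^2 \, \mathrm{d}x_1\cdots\mathrm{d}x_m=m!\prod_{1\le i<j\le 2m+1}\frac{y_i-y_j}{y_i+y_j}. \]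
   Context: For a partition $\lambda=(\lambda_1\ge\cdots\ge\lambda_N\ge 0)$, the Schur polynomial is the symmetric polynomial $s_\lambda(z_1,\ldots,z_N)=\det[z_i^{\lambda_j+N-j}]_{i,j=1}^N/\det[z_i^{N-j}]_{i,j=1}^N$; being a polynomial, it may be evaluated with repeated arguments. *)

theory Defs
  imports "HOL-Analysis.Analysis" "HOL-Probability.Probability" "Jordan_Normal_Form.Determinant"
begin

definition is_partition :: "nat \<Rightarrow> nat list \<Rightarrow> bool" where
  "is_partition N lam \<longleftrightarrow> length lam = N \<and> sorted_wrt (\<ge>) lam"

definition schur_ratio :: "nat \<Rightarrow> nat list \<Rightarrow> (nat \<Rightarrow> real) \<Rightarrow> real" where
  "schur_ratio N lam z =
     det (mat N N (\<lambda>(i,j). z i ^ (lam ! j + N - 1 - j)))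
     / det (mat N N (\<lambda>(i,j). z i ^ (N - 1 - j)))"

definition distinct_args :: "nat \<Rightarrow> (nat \<Rightarrow> real) set" where
  "distinct_args N = {w. \<forall>i<N. \<forall>j<N. i \<noteq> j \<longrightarrow> w i \<noteq> w j}"

text \<open>The Schur polynomial evaluated at z_0..z_(N-1): the value of the polynomial equal to the
  bialternant ratio, obtained as the (continuous) limit of the ratio through points with
  pairwise distinct coordinates (product topology on nat \<Rightarrow> real).\<close>
definition schur :: "nat \<Rightarrow> nat list \<Rightarrow> (nat \<Rightarrow> real) \<Rightarrow> real" where
  "schur N lam z = Lim (at z within distinct_args N) (schur_ratio N lam)"

end

theory Submission
  imports Defs "HOL-Combinatorics.Multiset_Permutations"
begin

text \<open>
  Merging the arguments of the bialternant in pairs turns the product of the Schur polynomial and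
  the powers of \<open>x\<^sub>i - x\<^sub>j\<close> into a determinant with rows \<open>x\<^sub>i ^ y\<^sub>j\<close> and \<open>y\<^sub>j x\<^sub>i ^ (y\<^sub>j - 1)\<close>,
  up to the sign \<open>(-1) ^ m\<close>. Integrating its Leibniz expansion term by term gives
  \<open>\<Sum>\<^sub>\<sigma> sgn \<sigma> \<Prod>\<^sub>i y\<^bsub>\<sigma>(2i+1)\<^esub> / (y\<^bsub>\<sigma>(2i)\<^esub> + y\<^bsub>\<sigma>(2i+1)\<^esub>)\<close>. Dividing by the antisymmetric product of all
  \<open>(y\<^sub>i - y\<^sub>j) / (y\<^sub>i + y\<^sub>j)\<close> leaves an unsigned sum over all orderings of the set of the \<open>y\<^sub>i\<close>,
  which is evaluated by splitting off the first two entries. In this way the even and the odd case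
  of Schur's Pfaffian identity are covered at once, and no Pfaffian is needed.
\<close>

section \<open>Rational function identities\<close>

lemma degree_prod_linear: "finite T \<Longrightarrow> degree (\<Prod>l\<in>T. [:- f l, 1::'a::idom:]) = card T"
  by (subst degree_prod_sum_eq) auto

lemma coeff_prod_linear: "finite T \<Longrightarrow> coeff (\<Prod>l\<in>T. [:- f l, 1::'a::idom:]) (card T) = 1"
  using lead_coeff_prod[of "\<lambda>l. [:- f l, 1::'a:]" T] by (simp add: degree_prod_linear)

text \<open>Lagrange interpolation at the points of \<open>S\<close> reproduces \<open>f\<close>,
  whose degree is below \<open>card S\<close>. The basis polynomials \<open>q k\<close> are monic of
  degree \<open>card S - 1\<close>, so the coefficients of that degree give the sum.\<close>

lemma sum_divided_difference:
  fixes f :: "'a::field poly"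
  assumes "finite S" "degree f < card S"
  shows "(\<Sum>k\<in>S. poly f k / (\<Prod>l\<in>S-{k}. k - l)) = coeff f (card S - 1)"
proof -
  define c where "c k = poly f k / (\<Prod>l\<in>S-{k}. k - l)" for k
  define q where "q k = (\<Prod>l\<in>S-{k}. [:- l, 1:])" for k
  define g where "g = (\<Sum>k\<in>S. Polynomial.smult (c k) (q k))"
  have deg: "degree (q k) = card S - 1" and lc: "coeff (q k) (card S - 1) = 1" if "k \<in> S" for k
    using that assms degree_prod_linear[of "S - {k}" "\<lambda>l. l"] coeff_prod_linear[of "S - {k}" "\<lambda>l. l"]
    by (simp_all add: q_def)
  have "f = g"
  proof (rule poly_eqI_degree[of S])
    fix x assume x: "x \<in> S"
    have "poly g x = (\<Sum>k\<in>S. if k = x then poly f k else 0)"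
      unfolding g_def poly_sum
    proof (rule sum.cong[OF refl])
      fix k assume "k \<in> S"
      show "poly (Polynomial.smult (c k) (q k)) x = (if k = x then poly f k else 0)"
      proof (cases "k = x")
        case True
        have "(\<Prod>l\<in>S-{k}. k - l) \<noteq> 0" using assms by auto
        then show ?thesis using True by (simp add: c_def q_def poly_prod)
      next
        case False
        then have "(\<Prod>l\<in>S-{k}. x - l) = 0" using assms x by (intro prod_zero) auto
        then show ?thesis using False by (simp add: q_def poly_prod)
      qed
    qed
    then show "poly f x = poly g x" using x assms by simp
  next
    have "degree g \<le> card S - 1" unfolding g_def
      using assms deg by (intro degree_sum_le) (auto intro: order.trans[OF degree_smult_le])
    then show "degree g < card S" using assms by linarith
  qed (use assms in auto)
  then have "coeff f (card S - 1) = (\<Sum>k\<in>S. c k * coeff (q k) (card S - 1))"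
    by (simp add: g_def coeff_sum)
  then show ?thesis using lc by (simp add: c_def)
qed

text \<open>The case \<open>t = -1\<close> of the Hall--Littlewood identity
  \<open>\<Sum>\<^sub>k \<Prod>\<^sub>l (x\<^sub>k - t x\<^sub>l) / (x\<^sub>k - x\<^sub>l) = (1 - t^n) / (1 - t)\<close>. It is the leading coefficient of
  the polynomial \<open>(\<Prod>\<^sub>l (X + x\<^sub>l) - (-1)^n \<Prod>\<^sub>l (X - x\<^sub>l)) / X\<close>, interpolated at the \<open>x\<^sub>k\<close>.\<close>

lemma sum_prod_plus_minus:
  fixes S :: "real set"
  assumes "finite S"
  shows "(\<Sum>k\<in>S. \<Prod>l\<in>S-{k}. (k + l) / (k - l)) = of_bool (odd (card S))"
proof (cases "S = {}")
  case False
  define n where "n = card S"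
  have n: "n > 0" using assms False by (auto simp: n_def card_gt_0_iff)
  define e where "e = (\<Prod>l\<in>S. [:- (- l), 1::real:])"
  define o' where "o' = (\<Prod>l\<in>S. [:- l, 1::real:])"
  define R where "R = e - Polynomial.smult ((-1)^n) o'"
  have de: "degree e = n" "coeff e n = 1" and do: "degree o' = n" "coeff o' n = 1"
    using degree_prod_linear[OF assms, of "\<lambda>l. -l"] coeff_prod_linear[OF assms, of "\<lambda>l. -l"]
      degree_prod_linear[OF assms, of "\<lambda>l. l"] coeff_prod_linear[OF assms, of "\<lambda>l. l"]
    by (simp_all add: e_def o'_def n_def)
  \<comment> \<open>At 0 both terms of \<open>R\<close> equal the product of the elements of
    \<open>S\<close>, since the two signs (-1)^n cancel.\<close>
  have "poly R 0 = 0"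
    by (simp add: R_def e_def o'_def poly_prod prod_uminus n_def flip: mult.assoc power_mult_distrib)
  then obtain Q where Q: "R = [:0, 1:] * Q" using poly_eq_0_iff_dvd[of R 0] by auto
  have cQ: "coeff Q (n - 1) = 1 - (-1)^n"
  proof -
    have "coeff R n = coeff Q (n - 1)" using Q n by (cases n) simp_all
    then show ?thesis by (simp add: R_def de do)
  qed
  have dQ: "degree Q < n"
  proof (cases "Q = 0")
    case False
    have "degree R \<le> n" unfolding R_def
      by (rule degree_diff_le) (auto simp: de do intro: order.trans[OF degree_smult_le])
    then show ?thesis using Q False by (simp add: degree_mult_eq)
  qed (use n in simp)
  have pQ: "poly Q k = 2 * (\<Prod>l\<in>S-{k}. k + l)" if k: "k \<in> S" for k
  proof (cases "k = 0")
    case False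
    have "k * poly Q k = poly R k" using Q by simp
    also have "(\<Prod>l\<in>S. k - l) = 0" using k assms by (intro prod_zero) auto
    then have "poly R k = (\<Prod>l\<in>S. k + l)"
      by (simp add: R_def e_def o'_def poly_prod add.commute)
    also have "\<dots> = k * (2 * (\<Prod>l\<in>S-{k}. k + l))"
      using k assms by (simp add: prod.remove[of S k])
    finally show ?thesis using False by simp
  next
    case True
    \<comment> \<open>At 0 the relation \<open>k * poly Q k = poly R k\<close> says nothing. But 0
      lies in \<open>S\<close>, so X can be cancelled in both products, which gives \<open>Q\<close>
      explicitly.\<close>
    have "R = [:0, 1:] * ((\<Prod>l\<in>S-{0}. [:l, 1:]) - Polynomial.smult ((-1)^n) (\<Prod>l\<in>S-{0}. [:- l, 1:]))"
      using k True assms unfolding R_def e_def o'_def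
      by (simp add: prod.remove[of S 0] smult_diff_right right_diff_distrib)
    then have "Q = (\<Prod>l\<in>S-{0}. [:l, 1:]) - Polynomial.smult ((-1)^n) (\<Prod>l\<in>S-{0}. [:- l, 1:])"
      using Q by (metis mult_left_cancel pCons_eq_0_iff one_neq_zero)
    moreover have "card (S - {0}) = n - 1" using k True assms by (simp add: n_def)
    ultimately show ?thesis using True n
      by (cases n) (simp_all add: poly_prod prod_uminus flip: mult.assoc power_mult_distrib)
  qed
  have "2 * (\<Sum>k\<in>S. \<Prod>l\<in>S-{k}. (k + l) / (k - l)) = (\<Sum>k\<in>S. poly Q k / (\<Prod>l\<in>S-{k}. k - l))"
    by (simp add: sum_distrib_left pQ prod_dividef)
  also have "\<dots> = 1 - (-1)^n"
    using sum_divided_difference[OF assms, of Q] dQ cQ by (simp add: n_def)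
  finally show ?thesis by (cases "even n") (simp_all add: n_def)
qed simp

text \<open>This is the previous identity for the set in which \<open>a\<close> is replaced by \<open>-a\<close>.\<close>

lemma sum_prod_pair:
  fixes S :: "real set"
  assumes "finite S" "a \<in> S" and sum_nz: "\<And>x y. x \<in> S \<Longrightarrow> y \<in> S \<Longrightarrow> x \<noteq> y \<Longrightarrow> x + y \<noteq> 0"
  shows "(\<Sum>b\<in>S-{a}. \<Prod>l\<in>S-{a,b}. (a + l) * (b + l) / ((a - l) * (b - l)))
    = 1 - of_bool (odd (card S)) * (\<Prod>l\<in>S-{a}. (a + l) / (a - l))"
proof -
  define T where "T = insert (-a) (S - {a})"
  have notin: "-a \<notin> S - {a}" using sum_nz[of a "-a"] assms by auto
  have [simp]: "finite T" using assms by (simp add: T_def)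
  have cT: "card T = card S"
    using assms notin by (simp add: T_def card_Suc_Diff1 del: card_Diff_insert)
  define c where "c k = (\<Prod>l\<in>T-{k}. (k + l) / (k - l))" for k
  define A where "A = (\<Prod>l\<in>S-{a}. (a + l) / (a - l))"
  have "A \<noteq> 0" using assms sum_nz[of a] by (auto simp: A_def)
  \<comment> \<open>Replacing \<open>a\<close> by \<open>-a\<close> inverts every factor of
    \<open>A\<close>.\<close>
  have cA: "c (-a) * A = 1"
  proof -
    have "T - {-a} = S - {a}" using notin by (auto simp: T_def)
    then have "c (-a) * A = (\<Prod>l\<in>S-{a}. (- a + l) / (- a - l) * ((a + l) / (a - l)))"
      by (simp only: c_def A_def prod.distrib)
    also have "\<dots> = (\<Prod>l\<in>S-{a}. 1)"
    proof (rule prod.cong[OF refl])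
      fix l assume "l \<in> S - {a}"
      then have "a + l \<noteq> 0" "a - l \<noteq> 0" using sum_nz[of a l] assms by auto
      moreover have "(- a + l) / (- a - l) = (a - l) / (a + l)"
        using minus_divide_divide[of "a - l" "a + l"] by simp
      ultimately show "(- a + l) / (- a - l) * ((a + l) / (a - l)) = 1" by simp
    qed
    finally show ?thesis by simp
  qed
  \<comment> \<open>Compared with the product over \<open>S - {a,b}\<close>, \<open>A\<close> has
    the extra factor (a + b)/(a - b), and \<open>c b\<close> has (b - a)/(b + a) from the element
    \<open>-a\<close> of \<open>T\<close>. These two multiply to -1.\<close>
  have Q: "(\<Prod>l\<in>S-{a,b}. (a + l) * (b + l) / ((a - l) * (b - l))) = - A * c b" if b: "b \<in> S - {a}" for b
  proof -
    have 1: "T - {b} = insert (-a) (S - {a,b})" using b notin by (auto simp: T_def)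
    have 2: "S - {a} = insert b (S - {a,b})" using b by auto
    have nz: "a + b \<noteq> 0" "a - b \<noteq> 0" using b assms sum_nz[of a b] by auto
    define u v where "u = (\<Prod>l\<in>S-{a,b}. (a + l) / (a - l))" and "v = (\<Prod>l\<in>S-{a,b}. (b + l) / (b - l))"
    define r s where "r = (a + b) / (a - b)" and "s = (b - a) / (b + a)"
    have "c b = s * v"
      unfolding c_def 1 v_def s_def using assms notin by (subst prod.insert) auto
    moreover have "A = r * u"
      unfolding A_def 2 u_def r_def using assms by (subst prod.insert) auto
    moreover have "r * s = -1"
      using nz by (simp add: r_def s_def divide_eq_eq add.commute[of b a])
    moreover have "- (r * u) * (s * v) = - (r * s) * (u * v)" by simp
    ultimately have "- A * c b = u * v" by simp
    then show ?thesis by (simp add: u_def v_def prod.distrib[symmetric])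
  qed
  have "(\<Sum>b\<in>S-{a}. \<Prod>l\<in>S-{a,b}. (a + l) * (b + l) / ((a - l) * (b - l))) = - A * (\<Sum>b\<in>S-{a}. c b)"
    unfolding sum_distrib_left by (intro sum.cong refl Q)
  also have "(\<Sum>b\<in>S-{a}. c b) = (\<Sum>b\<in>T. c b) - c (-a)"
    unfolding T_def using notin assms by (subst sum.insert) auto
  also have "(\<Sum>b\<in>T. c b) = of_bool (odd (card S))"
    unfolding c_def using sum_prod_plus_minus[of T] cT by simp
  also have "- A * (of_bool (odd (card S)) - c (-a)) = c (-a) * A - of_bool (odd (card S)) * A"
    by (simp add: algebra_simps)
  finally show ?thesis unfolding A_def[symmetric] unfolding cA .
qed

text \<open>The product is symmetric in a and b, and b/(a - b) + a/(b - a) = -1. So symmetrising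
  turns twice the sum into minus the sums of \<open>sum_prod_pair\<close> over all a. The value is
  the factor gained when the first two entries of an ordering are split off.\<close>

lemma sum_ordered_pairs:
  fixes S :: "real set"
  assumes "finite S" and sum_nz: "\<And>x y. x \<in> S \<Longrightarrow> y \<in> S \<Longrightarrow> x \<noteq> y \<Longrightarrow> x + y \<noteq> 0"
  shows "(\<Sum>a\<in>S. \<Sum>b\<in>S-{a}. b / (a - b) * (\<Prod>l\<in>S-{a,b}. (a + l) * (b + l) / ((a - l) * (b - l))))
    = - real (card S div 2)"
proof -
  define Q where "Q a b = (\<Prod>l\<in>S-{a,b}. (a + l) * (b + l) / ((a - l) * (b - l)))" for a b
  define X where "X = (\<Sum>a\<in>S. \<Sum>b\<in>S-{a}. b / (a - b) * Q a b)"
  have Q_sym: "Q a b = Q b a" for a b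
    unfolding Q_def by (simp add: insert_commute mult.commute)
  have swap: "(\<Sum>a\<in>S. \<Sum>b\<in>S-{a}. f a b) = (\<Sum>a\<in>S. \<Sum>b\<in>S-{a}. f b a)" for f :: "real \<Rightarrow> real \<Rightarrow> real"
    using sum.swap_restrict[OF assms(1) assms(1), of "\<lambda>a b. f a b" "\<lambda>a b. b \<noteq> a"]
    by (simp add: set_diff_eq eq_commute)
  have "2 * X = (\<Sum>a\<in>S. \<Sum>b\<in>S-{a}. b / (a - b) * Q a b) + (\<Sum>a\<in>S. \<Sum>b\<in>S-{a}. a / (b - a) * Q b a)"
    unfolding X_def using swap[of "\<lambda>a b. b / (a - b) * Q a b"] by simp
  also have "\<dots> = (\<Sum>a\<in>S. \<Sum>b\<in>S-{a}. - Q a b)"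
    unfolding sum.distrib[symmetric]
  proof (intro sum.cong refl)
    fix a b assume "a \<in> S" "b \<in> S - {a}"
    then have "a - b \<noteq> 0" by auto
    have "b / (a - b) + a / (b - a) = b / (a - b) - a / (a - b)"
      by (metis diff_minus_eq_add minus_diff_eq minus_divide_right)
    also have "\<dots> = (b - a) / (a - b)" by (rule diff_divide_distrib[symmetric])
    also have "\<dots> = -1" using \<open>a - b \<noteq> 0\<close> by (subst divide_eq_eq) simp
    finally have "b / (a - b) + a / (b - a) = -1" .
    then show "b / (a - b) * Q a b + a / (b - a) * Q b a = - Q a b"
      unfolding Q_sym[of b a] by (metis distrib_right mult_minus1)
  qed
  also have "\<dots> = - (\<Sum>a\<in>S. 1 - of_bool (odd (card S)) * (\<Prod>l\<in>S-{a}. (a + l) / (a - l)))"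
    unfolding sum_negf Q_def using assms by (simp add: sum_prod_pair cong: sum.cong)
  \<comment> \<open>The parity indicator occurs twice, once from \<open>sum_prod_pair\<close> and
    once from \<open>sum_prod_plus_minus\<close>. For odd \<open>card S\<close> it lowers the count
    by one.\<close>
  also have "\<dots> = - (real (card S) - of_bool (odd (card S)) * of_bool (odd (card S)))"
    unfolding sum_subtractf sum_distrib_left[symmetric] sum_prod_plus_minus[OF assms(1)] by simp
  also have "\<dots> = - 2 * real (card S div 2)"
    by (cases "even (card S)") (auto elim!: evenE oddE)
  finally show ?thesis by (simp add: X_def Q_def)
qed

section \<open>Signed sums over permutations\<close>

lemma det_vandermonde:
  fixes z :: "nat \<Rightarrow> 'a::idom"
  shows "det (mat N N (\<lambda>(i,j). z i ^ (N - 1 - j))) = (\<Prod>i<N. \<Prod>j\<in>{i<..<N}. z i - z j)"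
proof -
  define V where "V = mat N N (\<lambda>(i,j). z i ^ (N - 1 - j))"
  \<comment> \<open>unipotent column operations replace the powers by monic polynomials vanishing below the diagonal\<close>
  define q where "q j = (\<Prod>l\<in>{j<..<N}. [:- z l, 1:])" for j
  define C where "C = mat N N (\<lambda>(k,j). coeff (q j) (N - 1 - k))"
  have deg: "degree (q j) = N - 1 - j" and lc: "coeff (q j) (N - 1 - j) = 1" for j
    using degree_prod_linear[of "{j<..<N}" z] coeff_prod_linear[of "{j<..<N}" z]
    by (simp_all add: q_def)
  have VC: "V * C = mat N N (\<lambda>(i,j). poly (q j) (z i))"
  proof (rule eq_matI)
    fix i j assume "i < dim_row (mat N N (\<lambda>(i,j). poly (q j) (z i)))"
      "j < dim_col (mat N N (\<lambda>(i,j). poly (q j) (z i)))"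
    then have i: "i < N" and j: "j < N" by auto
    have "(V * C) $$ (i, j) = (\<Sum>k=0..<N. z i ^ (N - 1 - k) * coeff (q j) (N - 1 - k))"
      using i j by (simp add: V_def C_def scalar_prod_def)
    also have "\<dots> = (\<Sum>k<N. coeff (q j) k * z i ^ k)"
      by (rule sum.reindex_bij_witness[of _ "\<lambda>k. N - 1 - k" "\<lambda>k. N - 1 - k"]) auto
    also have "\<dots> = poly (q j) (z i)"
      using j deg[of j] le_degree[of "q j"]
      by (subst poly_altdef, intro sum.mono_neutral_right) auto
    finally show "(V * C) $$ (i, j) = mat N N (\<lambda>(i,j). poly (q j) (z i)) $$ (i, j)"
      using i j by simp
  qed (auto simp: V_def C_def)
  have "det C = prod_list (diag_mat C)"
  proof (rule det_lower_triangular[of N])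
    fix i j assume "i < j" "j < N"
    then show "C $$ (i,j) = 0" using deg[of j] by (simp add: C_def coeff_eq_0)
  qed (simp add: C_def)
  also have "diag_mat C = map (\<lambda>_. 1) [0..<N]"
    using lc by (simp add: diag_mat_def C_def)
  finally have "det C = 1" by (simp add: map_replicate_const)
  moreover have "V \<in> carrier_mat N N" "C \<in> carrier_mat N N" by (simp_all add: V_def C_def)
  ultimately have "det V = det (V * C)" by (simp add: det_mult)
  also have "\<dots> = prod_list (diag_mat (V * C))"
    by (rule det_upper_triangular[of _ N])
       (auto simp: VC upper_triangular_def q_def poly_prod)
  also have "diag_mat (V * C) = map (\<lambda>i. \<Prod>j\<in>{i<..<N}. z i - z j) [0..<N]"
    by (simp add: VC diag_mat_def q_def poly_prod)
  also have "prod_list \<dots> = (\<Prod>i<N. \<Prod>j\<in>{i<..<N}. z i - z j)"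
    by (simp add: prod.distinct_set_conv_list[symmetric] atLeast0LessThan)
  finally show ?thesis by (simp add: V_def)
qed

text \<open>Permuting the points permutes the rows of the Vandermonde matrix.\<close>

lemma prod_diff_permute:
  fixes z :: "nat \<Rightarrow> 'a::idom"
  assumes "p permutes {0..<N}"
  shows "(\<Prod>i<N. \<Prod>j\<in>{i<..<N}. z (p i) - z (p j)) = signof p * (\<Prod>i<N. \<Prod>j\<in>{i<..<N}. z i - z j)"
proof -
  define V where "V = mat N N (\<lambda>(i,j). z i ^ (N - 1 - j))"
  have "p i < N" if "i < N" for i using permutes_in_image[OF assms] that by simp
  then have "mat N N (\<lambda>(i,j). z (p i) ^ (N - 1 - j)) = mat N N (\<lambda>(i,j). V $$ (p i, j))"
    by (intro cong_mat) (auto simp: V_def)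
  then show ?thesis
    using det_permute_rows[OF _ assms, of V]
    by (simp add: V_def det_vandermonde[symmetric])
qed

lemma prod_schur_permute:
  fixes y :: "nat \<Rightarrow> real"
  assumes p: "p permutes {0..<N}" and "inj_on y {..<N}" and "\<And>i. i < N \<Longrightarrow> y i \<ge> 0"
  shows "(\<Prod>i<N. \<Prod>j\<in>{i<..<N}. (y (p i) - y (p j)) / (y (p i) + y (p j)))
    = signof p * (\<Prod>i<N. \<Prod>j\<in>{i<..<N}. (y i - y j) / (y i + y j))"
proof -
  \<comment> \<open>a quotient of Vandermonde products, in \<open>w\<close> and in \<open>w\<^sup>2\<close>\<close>
  have eq: "(\<Prod>i<N. \<Prod>j\<in>{i<..<N}. (w i - w j) / (w i + w j))
    = (\<Prod>i<N. \<Prod>j\<in>{i<..<N}. w i - w j)^2 / (\<Prod>i<N. \<Prod>j\<in>{i<..<N}. w i ^ 2 - w j ^ 2)"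
    if "inj_on w {..<N}" for w :: "nat \<Rightarrow> real"
    unfolding prod_power_distrib prod_dividef[symmetric]
  proof (intro prod.cong refl)
    fix i j assume "i \<in> {..<N}" "j \<in> {i<..<N}"
    then have "w i - w j \<noteq> 0" using that by (auto simp: inj_on_def)
    then show "(w i - w j) / (w i + w j) = (w i - w j)\<^sup>2 / ((w i)\<^sup>2 - (w j)\<^sup>2)"
      by (simp add: power2_eq_square square_diff_square_factored)
  qed
  have "inj_on (\<lambda>i. y (p i)) {..<N}"
    using comp_inj_on[of p "{..<N}" y] p assms(2)
    by (simp add: permutes_inj_on permutes_image atLeast0LessThan comp_def)
  \<comment> \<open>The sign squares away in the numerator and survives once, in the Vandermonde
    product of the squares.\<close>
  from eq[OF this] show ?thesis
    unfolding eq[OF assms(2)] prod_diff_permute[OF p] prod_diff_permute[OF p, of "\<lambda>i. (y i)\<^sup>2"]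
    by (simp add: sign_def power_mult_distrib)
qed

section \<open>Sums over the orderings of a finite set of reals\<close>

text \<open>On lists, splitting off the first two entries is one unfolding. The default 1 also
  covers the unpaired last entry of a list of odd length.\<close>

fun pairing_weight :: "real list \<Rightarrow> real" where
  "pairing_weight (a # b # xs) = b / (a + b) * pairing_weight xs"
| "pairing_weight _ = 1"

fun schur_weight :: "real list \<Rightarrow> real" where
  "schur_weight (a # xs) = (\<Prod>l\<leftarrow>xs. (a - l) / (a + l)) * schur_weight xs"
| "schur_weight [] = 1"

lemma pairing_weight_map_upt:
  "pairing_weight (map w [0..<N]) = (\<Prod>i<N div 2. w (2*i+1) / (w (2*i) + w (2*i+1)))"
proof (induction N arbitrary: w rule: induct_nat_012)
  case (ge2 n)
  have "map w [0..<Suc (Suc n)] = w 0 # w 1 # map (\<lambda>i. w (i+2)) [0..<n]"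
    by (simp add: map_upt_Suc del: upt_Suc)
  then show ?case using ge2(1)[of "\<lambda>i. w (i+2)"]
    by (simp add: prod.lessThan_Suc_shift del: upt_Suc prod.lessThan_Suc)
qed auto

lemma schur_weight_map_upt:
  "schur_weight (map w [0..<N]) = (\<Prod>i<N. \<Prod>j\<in>{i<..<N}. (w i - w j) / (w i + w j))"
proof (induction N arbitrary: w)
  case (Suc n)
  have "{0<..<Suc n} = Suc ` {..<n}" and *: "{Suc i<..<Suc n} = Suc ` {i<..<n}" for i
    by (auto simp: image_iff gr0_conv_Suc Suc_less_eq2)
  then show ?case using Suc[of "\<lambda>i. w (Suc i)"]
    by (simp add: map_upt_Suc prod.lessThan_Suc_shift prod.reindex comp_def
        prod.distinct_set_conv_list[symmetric] atLeast0LessThan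
        del: upt_Suc prod.lessThan_Suc)
qed simp

lemma schur_weight_nonzero:
  assumes "distinct xs" "\<And>x y. x \<in> set xs \<Longrightarrow> y \<in> set xs \<Longrightarrow> x \<noteq> y \<Longrightarrow> x + y \<noteq> 0"
  shows "schur_weight xs \<noteq> 0"
  using assms
proof (induction xs)
  case (Cons a xs)
  have "(a - l) / (a + l) \<noteq> 0" if "l \<in> set xs" for l
    using Cons.prems(1) Cons.prems(2)[of a l] that by auto
  then show ?case using Cons by (auto simp: prod_list_zero_iff)
qed simp

lemma sum_permutations_of_set_two:
  assumes "finite S" "card S \<ge> 2"
  shows "(\<Sum>xs\<in>permutations_of_set S. f xs)
    = (\<Sum>a\<in>S. \<Sum>b\<in>S-{a}. \<Sum>xs\<in>permutations_of_set (S-{a,b}). f (a # b # xs))"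
proof -
  have step: "(\<Sum>xs\<in>permutations_of_set T. g xs) = (\<Sum>a\<in>T. \<Sum>xs\<in>permutations_of_set (T-{a}). g (a # xs))"
    if "finite T" "T \<noteq> {}" for T and g :: "'a list \<Rightarrow> 'b"
    using that by (subst permutations_of_set_nonempty, simp, subst sum.UNION_disjoint)
      (auto simp: sum.reindex)
  have "S \<noteq> {}" using assms by auto
  moreover have "S - {a} \<noteq> {}" if "a \<in> S" for a using assms that
    by (metis One_nat_def card_Diff_singleton card.empty diff_is_0_eq not_less_eq_eq numeral_2_eq_2)
  moreover have "S - {a} - {b} = S - {a,b}" for a b by auto
  ultimately show ?thesis using assms by (simp add: step)
qed

text \<open>Induction removes two elements at a time. The sum over the tails depends only on the
  number of remaining elements, so it factors out, and \<open>sum_ordered_pairs\<close> supplies the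
  factor \<open>- real (card S div 2)\<close>. Parity enters only through the base cases of 0 and 1
  elements.\<close>

lemma sum_permutations_weight:
  fixes S :: "real set"
  assumes "finite S" "\<And>x y. x \<in> S \<Longrightarrow> y \<in> S \<Longrightarrow> x \<noteq> y \<Longrightarrow> x + y \<noteq> 0"
  shows "(\<Sum>xs\<in>permutations_of_set S. pairing_weight xs / schur_weight xs)
    = (-1) ^ (card S div 2) * fact (card S div 2)"
  using assms
proof (induction "card S" arbitrary: S rule: less_induct)
  case (less S)
  consider "card S = 0" | "card S = 1" | "card S \<ge> 2" by linarith
  then show ?case
  proof cases
    case 3
    define n where "n = card S div 2"
    have n: "n > 0" using 3 by (simp add: n_def)
    define Q where "Q a b = (\<Prod>l\<in>S-{a,b}. (a + l) * (b + l) / ((a - l) * (b - l)))" for a b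
    have "(\<Sum>xs\<in>permutations_of_set S. pairing_weight xs / schur_weight xs)
      = (\<Sum>a\<in>S. \<Sum>b\<in>S-{a}. \<Sum>xs\<in>permutations_of_set (S-{a,b}).
          b / (a - b) * Q a b * (pairing_weight xs / schur_weight xs))"
      unfolding sum_permutations_of_set_two[OF less.prems(1) 3]
    proof (intro sum.cong refl)
      fix a b xs assume a: "a \<in> S" and b: "b \<in> S - {a}" and xs: "xs \<in> permutations_of_set (S - {a,b})"
      have d: "distinct xs" "set xs = S - {a,b}" using xs by (auto simp: permutations_of_set_def)
      have "schur_weight (a # b # xs) = (a - b) / (a + b) *
          (\<Prod>l\<in>S-{a,b}. (a - l) * (b - l) / ((a + l) * (b + l))) * schur_weight xs"
        using d by (simp add: prod.distinct_set_conv_list[symmetric] prod.distrib[symmetric])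
      also have "(\<Prod>l\<in>S-{a,b}. (a - l) * (b - l) / ((a + l) * (b + l))) = inverse (Q a b)"
        unfolding Q_def prod_inversef[symmetric] by (intro prod.cong) simp_all
      finally have "schur_weight (a # b # xs) = (a - b) / (a + b) * inverse (Q a b) * schur_weight xs" .
      \<comment> \<open>The sum a + b, which is nonzero, cancels between the two weights and leaves
        b/(a - b).\<close>
      then show "pairing_weight (a # b # xs) / schur_weight (a # b # xs)
          = b / (a - b) * Q a b * (pairing_weight xs / schur_weight xs)"
        using less.prems(2)[of a b] a b by (simp add: divide_inverse ac_simps del: schur_weight.simps)
    qed
    also have "\<dots> = (\<Sum>a\<in>S. \<Sum>b\<in>S-{a}. b / (a - b) * Q a b * ((-1) ^ (n - 1) * fact (n - 1)))"
    proof (intro sum.cong refl)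
      fix a b assume a: "a \<in> S" and b: "b \<in> S - {a}"
      have c: "card (S - {a,b}) = card S - 2" using a b less.prems(1) by (simp add: card_Diff_subset)
      then have "card (S - {a,b}) div 2 = n - 1" by (simp add: n_def)
      then have "(\<Sum>xs\<in>permutations_of_set (S-{a,b}). pairing_weight xs / schur_weight xs)
          = (-1) ^ (n - 1) * fact (n - 1)"
        using less.hyps[of "S - {a,b}"] less.prems c 3 by simp
      then show "(\<Sum>xs\<in>permutations_of_set (S-{a,b}). b / (a - b) * Q a b * (pairing_weight xs / schur_weight xs))
          = b / (a - b) * Q a b * ((-1) ^ (n - 1) * fact (n - 1))"
        by (simp only: sum_distrib_left[symmetric])
    qed
    also have "\<dots> = - real n * ((-1) ^ (n - 1) * fact (n - 1))"
      unfolding sum_distrib_right[symmetric] Q_def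
      using sum_ordered_pairs[OF less.prems] by (simp add: n_def)
    also have "\<dots> = (-1) ^ n * fact n" using n by (cases n) (simp_all add: algebra_simps)
    finally show ?thesis by (simp add: n_def)
  qed (use less.prems in \<open>auto simp: card_1_singleton_iff\<close>)
qed

lemma sum_permutes_conv_permutations_of_set:
  assumes "inj_on y {..<N}"
  shows "(\<Sum>p | p permutes {0..<N}. f (map (\<lambda>i. y (p i)) [0..<N])) = (\<Sum>xs\<in>permutations_of_set (y ` {..<N}). f xs)"
proof (rule sum.reindex_bij_betw)
  let ?g = "\<lambda>p. map (\<lambda>i. y (p i)) [0..<N]"
  have inj: "inj_on ?g {p. p permutes {0..<N}}"
  proof (rule inj_onI)
    fix p q assume p: "p \<in> {p. p permutes {0..<N}}" and q: "q \<in> {p. p permutes {0..<N}}" and "?g p = ?g q"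
    then have "y (p i) = y (q i)" if "i < N" for i using that by auto
    moreover have "p i < N" "q i < N" if "i < N" for i
      using p q that permutes_in_image by fastforce+
    ultimately have "p i = q i" if "i < N" for i using assms that by (auto simp: inj_on_def)
    then show "p = q" using p q by (intro ext) (metis atLeastLessThan_iff le0 mem_Collect_eq permutes_def)
  qed
  moreover have "?g ` {p. p permutes {0..<N}} = permutations_of_set (y ` {..<N})"
  \<comment> \<open>Surjectivity comes from counting: by injectivity both sets have N!
    elements.\<close>
  proof (rule card_subset_eq)
    show "?g ` {p. p permutes {0..<N}} \<subseteq> permutations_of_set (y ` {..<N})"
    proof clarify
      fix p assume p: "p permutes {0..<N}"
      then have "p ` {..<N} = {..<N}" "inj_on p {..<N}"
        by (simp_all add: permutes_image permutes_inj_on atLeast0LessThan)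
      then show "?g p \<in> permutations_of_set (y ` {..<N})"
        using assms comp_inj_on[of p "{..<N}" y]
        by (intro permutations_of_setI)
           (auto simp: distinct_map comp_def atLeast0LessThan simp flip: image_image)
    qed
    show "card (?g ` {p. p permutes {0..<N}}) = card (permutations_of_set (y ` {..<N}))"
      using inj assms by (simp add: card_image card_permutations[of "{0..<N}" N])
  qed simp
  ultimately show "bij_betw ?g {p. p permutes {0..<N}} (permutations_of_set (y ` {..<N}))"
    by (simp add: bij_betw_def)
qed

text \<open>This is Schur's Pfaffian identity in expanded form, for both parities. Pulling out the
  antisymmetric product \<open>P\<close> absorbs \<open>signof p\<close> and leaves an unsigned sum
  over orderings of the values.\<close>

lemma sum_sign_pairing:
  fixes y :: "nat \<Rightarrow> real"
  assumes inj: "inj_on y {..<N}" and nonneg: "\<And>i. i < N \<Longrightarrow> y i \<ge> 0"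
  shows "(\<Sum>p | p permutes {0..<N}. signof p * (\<Prod>i<N div 2. y (p (2*i+1)) / (y (p (2*i)) + y (p (2*i+1)))))
    = (-1) ^ (N div 2) * fact (N div 2) * (\<Prod>i<N. \<Prod>j\<in>{i<..<N}. (y i - y j) / (y i + y j))"
proof -
  define P where "P = (\<Prod>i<N. \<Prod>j\<in>{i<..<N}. (y i - y j) / (y i + y j))"
  \<comment> \<open>Two distinct nonnegative numbers cannot both vanish.\<close>
  have nz: "a + b \<noteq> 0" if "a \<in> y ` {..<N}" "b \<in> y ` {..<N}" "a \<noteq> b" for a b
    using that nonneg by (force simp: add_nonneg_eq_0_iff)
  have "schur_weight (map y [0..<N]) \<noteq> 0"
    using inj nz by (intro schur_weight_nonzero) (auto simp: distinct_map atLeast0LessThan)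
  then have "P \<noteq> 0" by (simp add: P_def schur_weight_map_upt)
  have "(\<Sum>p | p permutes {0..<N}. signof p * (\<Prod>i<N div 2. y (p (2*i+1)) / (y (p (2*i)) + y (p (2*i+1)))))
    = (\<Sum>p | p permutes {0..<N}. P * (pairing_weight (map (\<lambda>i. y (p i)) [0..<N]) / schur_weight (map (\<lambda>i. y (p i)) [0..<N])))"
  proof (intro sum.cong refl)
    fix p assume "p \<in> {p. p permutes {0..<N}}"
    then have "schur_weight (map (\<lambda>i. y (p i)) [0..<N]) = signof p * P"
      using prod_schur_permute[of p N y] inj nonneg by (simp add: schur_weight_map_upt P_def)
    then show "signof p * (\<Prod>i<N div 2. y (p (2*i+1)) / (y (p (2*i)) + y (p (2*i+1))))
      = P * (pairing_weight (map (\<lambda>i. y (p i)) [0..<N]) / schur_weight (map (\<lambda>i. y (p i)) [0..<N]))"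
      using \<open>P \<noteq> 0\<close> by (simp add: pairing_weight_map_upt sign_def)
  qed
  also have "\<dots> = P * ((-1) ^ (N div 2) * fact (N div 2))"
    unfolding sum_distrib_left[symmetric]
    using sum_permutes_conv_permutations_of_set[OF inj, of "\<lambda>xs. pairing_weight xs / schur_weight xs"]
      sum_permutations_weight[of "y ` {..<N}"] nz inj
    by (simp add: card_image)
  finally show ?thesis by (simp add: P_def mult.commute)
qed

section \<open>The Schur polynomial at paired arguments\<close>

lemma prod_lessThan_pairs:
  fixes f :: "nat \<Rightarrow> 'a::comm_monoid_mult"
  shows "(\<Prod>i<N. f i) = (\<Prod>i<N div 2. f (2*i) * f (2*i+1)) * (if odd N then f (N - 1) else 1)"
  by (induction N rule: induct_nat_012) (auto simp: ac_simps)

text \<open>The indices are grouped into blocks {2a, 2a+1}, with a lone last block for odd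
  \<open>N\<close>. Leaving out the differences within a block keeps the part of the Vandermonde
  product that survives when pairs are merged.\<close>

definition cross_prod :: "nat \<Rightarrow> (nat \<Rightarrow> real) \<Rightarrow> real" where
  "cross_prod N w = (\<Prod>i<N. \<Prod>j<N. if i div 2 < j div 2 then w i - w j else 1)"

lemma prod_if_lessThan:
  fixes g :: "nat \<Rightarrow> 'a::comm_monoid_mult"
  shows "(\<Prod>j<N. if i < j then g j else 1) = (\<Prod>j\<in>{i<..<N}. g j)"
  by (subst prod.inter_filter[symmetric]) (auto intro!: prod.cong)

lemma prod_diff_conv_cross_prod:
  "(\<Prod>i<N. \<Prod>j\<in>{i<..<N}. w i - w j) = (\<Prod>i<N div 2. w (2*i) - w (2*i+1)) * cross_prod N w"
proof -
  \<comment> \<open>The one factor of row \<open>i\<close> inside its own block; it is 1 for the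
    second index of a pair and for an unpaired last index.\<close>
  define s where "s i = (if even i \<and> Suc i < N then w i - w (Suc i) else 1)" for i
  have "(\<Prod>j\<in>{i<..<N}. w i - w j) = s i * (\<Prod>j<N. if i div 2 < j div 2 then w i - w j else 1)" for i
  proof -
    have "(\<Prod>j\<in>{i<..<N}. w i - w j) = (\<Prod>j<N. if i < j then w i - w j else 1)"
      by (rule prod_if_lessThan[symmetric])
    also have "\<dots> = (\<Prod>j<N. (if j = Suc i then if even i then w i - w j else 1 else 1)
        * (if i div 2 < j div 2 then w i - w j else 1))"
    proof (intro prod.cong refl)
      fix j
      have "i < j \<longleftrightarrow> (even i \<and> j = Suc i) \<or> i div 2 < j div 2"
        "\<not> (even i \<and> j = Suc i \<and> i div 2 < j div 2)" by presburger+
      then show "(if i < j then w i - w j else 1) = (if j = Suc i then if even i then w i - w j else 1 else 1)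
        * (if i div 2 < j div 2 then w i - w j else 1)" by auto
    qed
    finally show ?thesis by (simp add: prod.distrib s_def prod.delta)
  qed
  moreover have "(\<Prod>i<N. s i) = (\<Prod>i<N div 2. w (2*i) - w (2*i+1))"
    unfolding prod_lessThan_pairs[of _ N] by (auto simp: s_def intro!: prod.cong)
  ultimately show ?thesis by (simp add: cross_prod_def prod.distrib)
qed

text \<open>The divided difference of the n-th power, written without division so that it becomes
  the derivative at a = b.\<close>

definition diff_quot :: "nat \<Rightarrow> real \<Rightarrow> real \<Rightarrow> real" where
  "diff_quot n a b = (\<Sum>k<n. b ^ (n - Suc k) * a ^ k)"

lemma diff_quot_mult: "(a - b) * diff_quot n a b = a ^ n - b ^ n"
  by (simp add: diff_quot_def power_diff_sumr2)

lemma diff_quot_same: "diff_quot n a a = real n * a ^ (n - 1)"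
proof -
  have "diff_quot n a a = (\<Sum>k<n. a ^ (n - 1))"
    unfolding diff_quot_def by (intro sum.cong refl) (simp flip: power_add)
  then show ?thesis by simp
qed

text \<open>When pairs are merged this is a confluent Vandermonde-type matrix, whose odd rows are
  derivatives of the rows above them.\<close>

definition paired_mat :: "nat \<Rightarrow> (nat \<Rightarrow> nat) \<Rightarrow> (nat \<Rightarrow> real) \<Rightarrow> real mat" where
  "paired_mat N e w = mat N N (\<lambda>(i,j). if odd i then diff_quot (e j) (w i) (w (i - 1)) else w i ^ e j)"

lemma det_power_conv_paired:
  "det (mat N N (\<lambda>(i,j). w i ^ e j)) = (\<Prod>i<N div 2. w (2*i+1) - w (2*i)) * det (paired_mat N e w)"
proof -
  \<comment> \<open>Left multiplication by \<open>T\<close> undoes the divided differences: an odd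
    row is the previous row plus \<open>w i - w (i - 1)\<close> times the divided difference. The
    diagonal of \<open>T\<close> carries the pair differences.\<close>
  define T where "T = mat N N (\<lambda>(i,k). if k = i then if odd i then w i - w (i - 1) else 1
    else if odd i \<and> k = i - 1 then 1 else (0::real))"
  have M: "paired_mat N e w \<in> carrier_mat N N" and T: "T \<in> carrier_mat N N"
    by (simp_all add: paired_mat_def T_def)
  have "T * paired_mat N e w = mat N N (\<lambda>(i,j). w i ^ e j)"
  proof (rule eq_matI)
    fix i j assume "i < dim_row (mat N N (\<lambda>(i,j). w i ^ e j))" "j < dim_col (mat N N (\<lambda>(i,j). w i ^ e j))"
    then have i: "i < N" and j: "j < N" by auto
    have "(T * paired_mat N e w) $$ (i, j) = (\<Sum>k=0..<N. T $$ (i,k) * paired_mat N e w $$ (k,j))"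
      using i j M T by (simp add: scalar_prod_def)
    also have "\<dots> = (\<Sum>k\<in>(if odd i then {i, i-1} else {i}). T $$ (i,k) * paired_mat N e w $$ (k,j))"
      using i by (intro sum.mono_neutral_right) (auto simp: T_def)
    also have "\<dots> = w i ^ e j"
      using i j diff_quot_mult[of "w i" "w (i - 1)" "e j"]
      by (auto simp: T_def paired_mat_def elim!: oddE)
    finally show "(T * paired_mat N e w) $$ (i, j) = mat N N (\<lambda>(i,j). w i ^ e j) $$ (i, j)"
      using i j by simp
  qed (use M T in auto)
  then have "det (mat N N (\<lambda>(i,j). w i ^ e j)) = det T * det (paired_mat N e w)"
    using det_mult[OF T M] by simp
  also have "det T = prod_list (diag_mat T)"
    using T by (intro det_lower_triangular[of N]) (auto simp: T_def)
  also have "\<dots> = (\<Prod>i<N. if odd i then w i - w (i - 1) else 1)"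
    using T by (simp add: diag_mat_def prod.distinct_set_conv_list[symmetric] atLeast0LessThan)
      (auto simp: T_def intro!: prod.cong)
  also have "\<dots> = (\<Prod>i<N div 2. w (2*i+1) - w (2*i))"
    by (subst prod_lessThan_pairs) simp
  finally show ?thesis .
qed

text \<open>The pair differences cancel, but the numerator has them in the opposite order, whence
  the sign. The right-hand side makes sense at merged pairs too.\<close>

lemma schur_ratio_paired:
  assumes "w \<in> distinct_args N"
  shows "schur_ratio N lam w
    = (-1) ^ (N div 2) * det (paired_mat N (\<lambda>j. lam ! j + N - 1 - j) w) / cross_prod N w"
proof -
  define q where "q = (\<Prod>i<N div 2. w (2*i) - w (2*i+1))"
  have "q \<noteq> 0" using assms by (auto simp: q_def distinct_args_def)
  moreover have "(\<Prod>i<N div 2. w (2*i+1) - w (2*i)) = (-1) ^ (N div 2) * q"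
    using prod_uminus[of "\<lambda>i. w (2*i) - w (2*i+1)" "{..<N div 2}"] by (simp add: q_def)
  ultimately show ?thesis
    using prod_diff_conv_cross_prod[of w N, folded q_def]
      det_power_conv_paired[of N w "\<lambda>j. lam ! j + N - 1 - j"]
    by (simp add: schur_ratio_def det_vandermonde[of N w, simplified])
qed

section \<open>Limits through points with distinct coordinates\<close>

lemma tendsto_coordinate: "((\<lambda>w. w i) \<longlongrightarrow> z i) (at z within A)" for z :: "'i \<Rightarrow> 'a::topological_space"
  using continuous_on_product_coordinates[of i]
  by (auto simp: continuous_on_def intro: tendsto_within_subset)

text \<open>Uniqueness of the limit in \<open>schur\<close> requires a nontrivial filter, that is,
  points of \<open>distinct_args N\<close> other than \<open>z\<close> arbitrarily close to
  \<open>z\<close>.\<close>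

lemma at_within_distinct_args: "at z within distinct_args N \<noteq> bot"
proof
  assume bot: "at z within distinct_args N = bot"
  \<comment> \<open>For small t > 0 the term \<open>t * real i\<close> separates coordinates that
    agree in \<open>z\<close>; the last summand moves coordinate 0, so that \<open>g t\<close>
    differs from \<open>z\<close>.\<close>
  define g where "g t = (\<lambda>i. z i + t * real i + t)" for t
  have "filterlim g (at z within distinct_args N) (at_right 0)"
    unfolding filterlim_at
  proof
    have g0: "g 0 = z" by (simp add: g_def)
    have "continuous_on UNIV g"
      unfolding g_def by (intro continuous_on_coordinatewise_then_product continuous_intros)
    then show "(g \<longlongrightarrow> z) (at_right 0)"
      unfolding continuous_on_def using g0 by (metis UNIV_I subset_UNIV tendsto_within_subset)
    have "eventually (\<lambda>t. g t i \<noteq> g t j) (at_right 0)" if "i \<noteq> j" for i j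
    proof (cases "z i = z j")
      case True
      have "eventually (\<lambda>t::real. t > 0) (at_right 0)" by (rule eventually_at_right_less)
      then show ?thesis by eventually_elim (use True that in \<open>auto simp: g_def\<close>)
    next
      case False
      have "((\<lambda>t. g t i - g t j) \<longlongrightarrow> z i - z j) (at_right 0)"
        unfolding g_def by (auto intro!: tendsto_eq_intros)
      then show ?thesis using tendsto_imp_eventually_ne[of _ "z i - z j" _ 0] False by force
    qed
    then have "eventually (\<lambda>t. \<forall>i\<in>{..<N}. \<forall>j\<in>{..<N}. i \<noteq> j \<longrightarrow> g t i \<noteq> g t j) (at_right 0)"
      by (intro eventually_ball_finite) (auto intro!: eventually_ball_finite simp: eventually_conj_iff)
    moreover have "eventually (\<lambda>t::real. t > 0) (at_right 0)" by (rule eventually_at_right_less)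
    ultimately show "eventually (\<lambda>t. g t \<in> distinct_args N \<and> g t \<noteq> z) (at_right 0)"
      by eventually_elim (auto simp: distinct_args_def g_def fun_eq_iff intro!: exI[of _ 0])
  qed
  then show False using bot by (simp add: filterlim_def bot.extremum_unique filtermap_bot_iff)
qed

lemma tendsto_det_paired: "((\<lambda>w. det (paired_mat N e w)) \<longlongrightarrow> det (paired_mat N e z)) (at z within A)"
proof -
  have "((\<lambda>w. paired_mat N e w $$ (i,j)) \<longlongrightarrow> paired_mat N e z $$ (i,j)) (at z within A)"
    if "i < N" "j < N" for i j
    using that by (cases "odd i") (auto simp: paired_mat_def diff_quot_def intro!: tendsto_intros tendsto_coordinate)
  note entry = this
  have det: "det (paired_mat N e w)
    = (\<Sum>p | p permutes {0..<N}. signof p * (\<Prod>i=0..<N. paired_mat N e w $$ (i, p i)))" for w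
    by (rule det_def') (simp add: paired_mat_def)
  show ?thesis
    unfolding det
  proof (intro tendsto_sum tendsto_mult tendsto_const tendsto_prod entry)
    fix p i assume "p \<in> {p. p permutes {0..<N}}" "i \<in> {0..<N}"
    then show "i < N" "p i < N" using permutes_in_image[of p "{0..<N}" i] by simp_all
  qed
qed

lemma tendsto_cross_prod: "(cross_prod N \<longlongrightarrow> cross_prod N z) (at z within A)"
proof -
  have "((\<lambda>w. if i div 2 < j div 2 then w i - w j else 1)
    \<longlongrightarrow> (if i div 2 < j div 2 then z i - z j else 1)) (at z within A)" for i j :: nat
    by (auto intro!: tendsto_intros tendsto_coordinate)
  then show ?thesis unfolding cross_prod_def by (intro tendsto_prod)
qed

text \<open>Where \<open>cross_prod\<close> is nonzero, the formula for the ratio extends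
  continuously. The product form also holds where \<open>cross_prod\<close> vanishes, because two
  rows of the matrix then coincide; hence no null set has to be removed from the integral.\<close>

lemma schur_mult_cross_prod:
  assumes pairs: "\<And>i. Suc (2*i) < N \<Longrightarrow> z (Suc (2*i)) = z (2*i)"
  shows "schur N lam z * cross_prod N z
    = (-1) ^ (N div 2) * det (paired_mat N (\<lambda>j. lam ! j + N - 1 - j) z)"
proof (cases "cross_prod N z = 0")
  case False
  let ?g = "\<lambda>w. (-1) ^ (N div 2) * det (paired_mat N (\<lambda>j. lam ! j + N - 1 - j) w) / cross_prod N w"
  have "(?g \<longlongrightarrow> ?g z) (at z within distinct_args N)"
    by (intro tendsto_intros tendsto_det_paired tendsto_cross_prod False)
  moreover have "eventually (\<lambda>w. ?g w = schur_ratio N lam w) (at z within distinct_args N)"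
    by (simp add: eventually_at_filter schur_ratio_paired)
  ultimately have "(schur_ratio N lam \<longlongrightarrow> ?g z) (at z within distinct_args N)"
    by (rule Lim_transform_eventually)
  then have "schur N lam z = ?g z"
    unfolding schur_def using at_within_distinct_args by (intro tendsto_Lim)
  then show ?thesis using False by simp
next
  case True
  then obtain i j where ij: "i < N" "j < N" "i div 2 < j div 2" "z i = z j"
    by (auto simp: cross_prod_def split: if_splits)
  \<comment> \<open>An equality between coordinates of different blocks passes to the even indices
    of these blocks, whose rows are plain powers.\<close>
  have even: "z (2 * (k div 2)) = z k" if "k < N" for k
    using pairs[of "k div 2"] that by (cases "even k") auto
  have "det (paired_mat N e z) = 0" for e
  proof (rule det_identical_rows)
    show "row (paired_mat N e z) (2 * (i div 2)) = row (paired_mat N e z) (2 * (j div 2))"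
      using ij even[of i] even[of j] by (intro eq_vecI) (auto simp: paired_mat_def)
  qed (use ij in \<open>auto simp: paired_mat_def\<close>)
  then show ?thesis using True by simp
qed

section \<open>Integration\<close>

text \<open>Two full blocks contribute four equal factors, a full block and the lone last index
  two.\<close>

lemma cross_prod_paired:
  assumes "\<And>a. a < N div 2 \<Longrightarrow> z (2*a) = x a" "\<And>a. a < N div 2 \<Longrightarrow> z (2*a+1) = x a"
  shows "cross_prod N z = (\<Prod>i<N div 2. \<Prod>j\<in>{i<..<N div 2}. (x i - x j) ^ 4)
    * (if odd N then \<Prod>i<N div 2. (x i - z (N - 1))\<^sup>2 else 1)"
proof -
  define m where "m = N div 2"
  define R where "R i = (\<Prod>j<N. if i div 2 < j div 2 then z i - z j else 1)" for i
  define c where "c a = (if odd N then x a - z (N - 1) else 1)" for a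
  have last: "(N - 1) div 2 = m" if "odd N" using that by (auto simp: m_def elim!: oddE)
  have R: "R i = (\<Prod>b\<in>{a<..<m}. (x a - x b)\<^sup>2) * c a" if "i div 2 = a" "z i = x a" "a < m" for i a
  proof -
    have "R i = (\<Prod>b<m. (if a < b then (x a - x b)\<^sup>2 else 1)) * c a"
      unfolding R_def prod_lessThan_pairs[of _ N] using that last assms
      by (intro arg_cong2[of _ _ _ _ "(*)"] prod.cong) (auto simp: c_def m_def power2_eq_square)
    then show ?thesis by (simp only: prod_if_lessThan)
  qed
  have "R (N - 1) = 1" if "odd N"
    unfolding R_def using last that by (intro prod.neutral) (auto simp: m_def dest: div_le_mono[of _ "N - 1" 2])
  then have "cross_prod N z = (\<Prod>a<m. R (2*a) * R (2*a+1))"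
    unfolding cross_prod_def R_def[symmetric] by (subst prod_lessThan_pairs) (simp add: m_def)
  also have "\<dots> = (\<Prod>a<m. (\<Prod>b\<in>{a<..<m}. (x a - x b) ^ 4) * (c a)\<^sup>2)"
  proof (intro prod.cong refl)
    fix a assume "a \<in> {..<m}"
    then have "R (2*a) = (\<Prod>b\<in>{a<..<m}. (x a - x b)\<^sup>2) * c a"
      "R (2*a+1) = (\<Prod>b\<in>{a<..<m}. (x a - x b)\<^sup>2) * c a"
      using assms R[of "2*a" a] R[of "2*a+1" a] by (simp_all add: m_def)
    then have "R (2*a) * R (2*a+1) = (\<Prod>b\<in>{a<..<m}. (x a - x b)\<^sup>2)\<^sup>2 * (c a)\<^sup>2"
      by (simp add: power2_eq_square)
    then show "R (2*a) * R (2*a+1) = (\<Prod>b\<in>{a<..<m}. (x a - x b) ^ 4) * (c a)\<^sup>2"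
      by (simp add: prod_power_distrib)
  qed
  finally show ?thesis by (simp add: prod.distrib c_def m_def)
qed

text \<open>In the Leibniz expansion, rows 2a and 2a+1 involve only \<open>x a\<close>, and the
  unpaired last row consists of ones.\<close>

lemma det_paired_expand:
  assumes "\<And>a. a < N div 2 \<Longrightarrow> z (2*a) = x a" "\<And>a. a < N div 2 \<Longrightarrow> z (2*a+1) = x a"
    and "odd N \<Longrightarrow> z (N - 1) = 1"
  shows "det (paired_mat N e z) = (\<Sum>p | p permutes {0..<N}. signof p *
    (\<Prod>a<N div 2. x a ^ e (p (2*a)) * (real (e (p (2*a+1))) * x a ^ (e (p (2*a+1)) - 1))))"
proof -
  have "(\<Prod>i<N. paired_mat N e z $$ (i, p i))
    = (\<Prod>a<N div 2. x a ^ e (p (2*a)) * (real (e (p (2*a+1))) * x a ^ (e (p (2*a+1)) - 1)))"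
    if p: "p permutes {0..<N}" for p
  proof -
    have "p i < N" if "i < N" for i using permutes_in_image[OF p] that by simp
    then have "(\<Prod>i<N. paired_mat N e z $$ (i, p i))
      = (\<Prod>i<N. if odd i then diff_quot (e (p i)) (z i) (z (i - 1)) else z i ^ e (p i))"
      by (intro prod.cong) (auto simp: paired_mat_def)
    also have "\<dots> = (\<Prod>a<N div 2. x a ^ e (p (2*a)) * (real (e (p (2*a+1))) * x a ^ (e (p (2*a+1)) - 1)))"
      unfolding prod_lessThan_pairs[of _ N] using assms
      by (auto intro!: prod.cong simp: diff_quot_same)
    finally show ?thesis .
  qed
  then show ?thesis
    by (subst det_def'[of _ N]) (auto simp: paired_mat_def atLeast0LessThan intro!: sum.cong)
qed

lemma integral_pair:
  fixes k l :: nat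
  assumes "k \<noteq> l"
  shows "integrable lborel (\<lambda>t::real. t ^ k * (real l * t ^ (l - 1)) * indicator {0..1} t)"
    and "(\<integral>t. t ^ k * (real l * t ^ (l - 1)) * indicator {0..1} t \<partial>lborel) = real l / (real k + real l)"
proof -
  show "integrable lborel (\<lambda>t::real. t ^ k * (real l * t ^ (l - 1)) * indicator {0..1} t)"
    by (intro borel_integrable_atLeastAtMost) (auto intro!: continuous_intros)
  show "(\<integral>t. t ^ k * (real l * t ^ (l - 1)) * indicator {0..1} t \<partial>lborel) = real l / (real k + real l)"
  \<comment> \<open>For \<open>l = 0\<close> the factor \<open>real l\<close> makes both sides 0,
    despite the truncated exponent \<open>l - 1\<close>.\<close>
  proof (cases l)
    case (Suc n)
    have "(\<integral>t. t ^ k * (real l * t ^ (l - 1)) * indicator {0..1} t \<partial>lborel)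
      = (\<integral>t. real l * (t ^ (k + n) * indicator {0..1} t) \<partial>lborel)"
      by (intro Bochner_Integration.integral_cong) (auto simp: Suc power_add)
    also have "\<dots> = real l / (real k + real l)"
      using integral_power[of 0 1 "k + n"] by (simp add: Suc add.commute add.left_commute)
    finally show ?thesis .
  qed simp
qed

text \<open>Each Leibniz term is a product of functions of one variable each, so its integral over
  the cube is a product of one-dimensional integrals.\<close>

lemma integral_det_paired:
  fixes z :: "(nat \<Rightarrow> real) \<Rightarrow> nat \<Rightarrow> real"
  assumes "\<And>x a. a < N div 2 \<Longrightarrow> z x (2*a) = x a" "\<And>x a. a < N div 2 \<Longrightarrow> z x (2*a+1) = x a"
    and "\<And>x. odd N \<Longrightarrow> z x (N - 1) = 1" and inj: "inj_on e {..<N}"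
  shows "(\<integral>x. det (paired_mat N e (z x)) * indicator ({..<N div 2} \<rightarrow>\<^sub>E {0..1}) x
      \<partial>(\<Pi>\<^sub>M i\<in>{..<N div 2}. lborel))
    = (\<Sum>p | p permutes {0..<N}. signof p *
        (\<Prod>a<N div 2. real (e (p (2*a+1))) / (real (e (p (2*a))) + real (e (p (2*a+1))))))"
proof -
  define m where "m = N div 2"
  define \<phi> where "\<phi> p a t = t ^ e (p (2*a)) * (real (e (p (2*a+1))) * t ^ (e (p (2*a+1)) - 1)) * indicator {0..1} t"
    for p :: "nat \<Rightarrow> nat" and a and t :: real
  interpret product_sigma_finite "\<lambda>_::nat. lborel :: real measure" by standard
  have ne: "e (p (2*a)) \<noteq> e (p (2*a+1))" if p: "p permutes {0..<N}" and a: "a < m" for p a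
  proof -
    have "2*a < N" "2*a+1 < N" using a by (auto simp: m_def)
    moreover from this have "p (2*a) < N" "p (2*a+1) < N"
      using permutes_in_image[OF p] by simp_all
    moreover have "p (2*a) \<noteq> p (2*a+1)"
      using inj_eq[OF permutes_inj[OF p]] by simp
    ultimately show ?thesis using inj by (auto simp: inj_on_def)
  qed
  have int: "integrable (\<Pi>\<^sub>M i\<in>{..<m}. lborel) (\<lambda>x. \<Prod>a<m. \<phi> p a (x a))"
    and val: "(\<integral>x. (\<Prod>a<m. \<phi> p a (x a)) \<partial>(\<Pi>\<^sub>M i\<in>{..<m}. lborel))
      = (\<Prod>a<m. real (e (p (2*a+1))) / (real (e (p (2*a))) + real (e (p (2*a+1)))))"
    if p: "p permutes {0..<N}" for p
  proof -
    have i: "integrable lborel (\<phi> p a)" if "a \<in> {..<m}" for a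
      unfolding \<phi>_def using ne[OF p, of a] that by (intro integral_pair) auto
    then show "integrable (\<Pi>\<^sub>M i\<in>{..<m}. lborel) (\<lambda>x. \<Prod>a<m. \<phi> p a (x a))"
      by (intro product_integrable_prod) auto
    have "(\<integral>x. (\<Prod>a<m. \<phi> p a (x a)) \<partial>(\<Pi>\<^sub>M i\<in>{..<m}. lborel)) = (\<Prod>a<m. integral\<^sup>L lborel (\<phi> p a))"
      using i by (intro product_integral_prod) auto
    also have "\<dots> = (\<Prod>a<m. real (e (p (2*a+1))) / (real (e (p (2*a))) + real (e (p (2*a+1)))))"
      unfolding \<phi>_def using ne[OF p] by (intro prod.cong refl integral_pair) auto
    finally show "(\<integral>x. (\<Prod>a<m. \<phi> p a (x a)) \<partial>(\<Pi>\<^sub>M i\<in>{..<m}. lborel))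
      = (\<Prod>a<m. real (e (p (2*a+1))) / (real (e (p (2*a))) + real (e (p (2*a+1)))))" .
  qed
  have "(\<integral>x. det (paired_mat N e (z x)) * indicator ({..<m} \<rightarrow>\<^sub>E {0..1}) x \<partial>(\<Pi>\<^sub>M i\<in>{..<m}. lborel))
    = (\<integral>x. (\<Sum>p | p permutes {0..<N}. signof p * (\<Prod>a<m. \<phi> p a (x a))) \<partial>(\<Pi>\<^sub>M i\<in>{..<m}. lborel))"
  proof (rule Bochner_Integration.integral_cong[OF refl])
    fix x :: "nat \<Rightarrow> real" assume "x \<in> space (\<Pi>\<^sub>M i\<in>{..<m}. lborel)"
    then have "x \<in> {..<m} \<rightarrow>\<^sub>E UNIV" by (simp add: space_PiM)
    \<comment> \<open>Points of the product space are extensional, so membership in the cube can be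
      tested coordinate by coordinate.\<close>
    then have "indicator ({..<m} \<rightarrow>\<^sub>E {0..1}) x = (\<Prod>a<m. indicator {0..1} (x a) :: real)"
      by (auto simp: indicator_def PiE_iff)
    moreover have "det (paired_mat N e (z x)) = (\<Sum>p | p permutes {0..<N}. signof p *
        (\<Prod>a<N div 2. x a ^ e (p (2*a)) * (real (e (p (2*a+1))) * x a ^ (e (p (2*a+1)) - 1))))"
      by (rule det_paired_expand) (use assms in auto)
    ultimately show "det (paired_mat N e (z x)) * indicator ({..<m} \<rightarrow>\<^sub>E {0..1}) x
      = (\<Sum>p | p permutes {0..<N}. signof p * (\<Prod>a<m. \<phi> p a (x a)))"
      by (simp only: \<phi>_def prod.distrib m_def sum_distrib_right mult.assoc)
  qed
  also have "\<dots> = (\<Sum>p | p permutes {0..<N}. signof p *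
      (\<integral>x. (\<Prod>a<m. \<phi> p a (x a)) \<partial>(\<Pi>\<^sub>M i\<in>{..<m}. lborel)))"
    using int by (subst Bochner_Integration.integral_sum) auto
  also have "\<dots> = (\<Sum>p | p permutes {0..<N}. signof p *
        (\<Prod>a<m. real (e (p (2*a+1))) / (real (e (p (2*a))) + real (e (p (2*a+1))))))"
    using val by (intro sum.cong refl) simp
  finally show ?thesis by (simp only: m_def)
qed

text \<open>Both cases of the theorem are instances, with \<open>z\<close> describing the repeated
  arguments and, for odd \<open>N\<close>, the final argument 1.\<close>

lemma integral_schur_paired:
  fixes z :: "(nat \<Rightarrow> real) \<Rightarrow> nat \<Rightarrow> real"
  assumes part: "is_partition N lam"
    and z: "\<And>x a. a < N div 2 \<Longrightarrow> z x (2*a) = x a" "\<And>x a. a < N div 2 \<Longrightarrow> z x (2*a+1) = x a"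
      "\<And>x. odd N \<Longrightarrow> z x (N - 1) = 1"
    and y: "\<And>k. k < N \<Longrightarrow> y k = real N + real (lam ! k) - real (k + 1)"
  shows "(\<integral>x. schur N lam (z x) * cross_prod N (z x) * indicator ({..<N div 2} \<rightarrow>\<^sub>E {0..1}) x
      \<partial>(\<Pi>\<^sub>M i\<in>{..<N div 2}. lborel))
    = fact (N div 2) * (\<Prod>i<N. \<Prod>j\<in>{i<..<N}. (y i - y j) / (y i + y j))"
proof -
  define e where "e j = lam ! j + N - 1 - j" for j
  have ye: "real (e k) = y k" if "k < N" for k
    using that y[OF that] by (simp add: e_def of_nat_diff)
  \<comment> \<open>The parts decrease weakly and the shift \<open>N - 1 - j\<close>
    strictly.\<close>
  have "e j < e i" if "i < j" "j < N" for i j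
    using that part sorted_wrt_nth_less[of "(\<ge>)" lam i j] by (auto simp: is_partition_def e_def)
  then have inj: "inj_on e {..<N}"
    by (metis inj_onI lessThan_iff less_irrefl nat_neq_iff)
  have schur: "schur N lam (z x) * cross_prod N (z x) = (-1) ^ (N div 2) * det (paired_mat N e (z x))" for x
    unfolding e_def
  proof (rule schur_mult_cross_prod)
    show "z x (Suc (2*i)) = z x (2*i)" if "Suc (2*i) < N" for i
      using z(1,2)[of i x] that by simp
  qed
  have "(\<integral>x. schur N lam (z x) * cross_prod N (z x) * indicator ({..<N div 2} \<rightarrow>\<^sub>E {0..1}) x
      \<partial>(\<Pi>\<^sub>M i\<in>{..<N div 2}. lborel))
    = (\<integral>x. (-1) ^ (N div 2) * (det (paired_mat N e (z x)) * indicator ({..<N div 2} \<rightarrow>\<^sub>E {0..1}) x)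
      \<partial>(\<Pi>\<^sub>M i\<in>{..<N div 2}. lborel))"
    by (simp only: schur mult.assoc)
  also have "\<dots> = (-1) ^ (N div 2) * ((-1) ^ (N div 2) * fact (N div 2) *
      (\<Prod>i<N. \<Prod>j\<in>{i<..<N}. (real (e i) - real (e j)) / (real (e i) + real (e j))))"
    using integral_det_paired[of N z e] z inj sum_sign_pairing[of "\<lambda>i. real (e i)" N]
    by (simp add: inj_on_def)
  \<comment> \<open>The sign from merging the pairs cancels the sign from the sum over
    orderings.\<close>
  also have "\<dots> = fact (N div 2) * (\<Prod>i<N. \<Prod>j\<in>{i<..<N}. (real (e i) - real (e j)) / (real (e i) + real (e j)))"
    by (simp flip: mult.assoc power_mult_distrib)
  also have "(\<Prod>i<N. \<Prod>j\<in>{i<..<N}. (real (e i) - real (e j)) / (real (e i) + real (e j)))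
    = (\<Prod>i<N. \<Prod>j\<in>{i<..<N}. (y i - y j) / (y i + y j))"
    by (intro prod.cong refl) (simp add: ye)
  finally show ?thesis .
qed

theorem theorem3p5:
  fixes m :: nat
  assumes "m > 0"
  shows
   "(\<forall>lam. is_partition (2*m) lam \<longrightarrow>
      (\<integral>x. schur (2*m) lam (\<lambda>k. x (k div 2))
              * (\<Prod>i<m. \<Prod>j\<in>{i<..<m}. (x i - x j) ^ 4)
              * indicator ({..<m} \<rightarrow>\<^sub>E {0..1}) x
        \<partial>(\<Pi>\<^sub>M i\<in>{..<m}. lborel))
      = fact m * (\<Prod>i<2*m. \<Prod>j\<in>{i<..<2*m}.
           let y = (\<lambda>k. real (2*m) + real (lam ! k) - real (k+1)) in (y i - y j) / (y i + y j)))
    \<and>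
    (\<forall>lam. is_partition (2*m+1) lam \<longrightarrow>
      (\<integral>x. schur (2*m+1) lam (\<lambda>k. if k < 2*m then x (k div 2) else 1)
              * (\<Prod>i<m. \<Prod>j\<in>{i<..<m}. (x i - x j) ^ 4)
              * (\<Prod>i<m. (1 - x i) ^ 2)
              * indicator ({..<m} \<rightarrow>\<^sub>E {0..1}) x
        \<partial>(\<Pi>\<^sub>M i\<in>{..<m}. lborel))
      = fact m * (\<Prod>i<2*m+1. \<Prod>j\<in>{i<..<2*m+1}.
           let y = (\<lambda>k. real (2*m+1) + real (lam ! k) - real (k+1)) in (y i - y j) / (y i + y j)))"
proof (intro conjI allI impI)
  fix lam assume lam: "is_partition (2*m) lam"
  have "cross_prod (2*m) (\<lambda>k. x (k div 2)) = (\<Prod>i<m. \<Prod>j\<in>{i<..<m}. (x i - x j) ^ 4)" for x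
    by (subst cross_prod_paired[where x = x]) simp_all
  with integral_schur_paired[OF lam, of "\<lambda>x k. x (k div 2)" "\<lambda>k. real (2*m) + real (lam ! k) - real (k+1)"]
  show "(\<integral>x. schur (2*m) lam (\<lambda>k. x (k div 2))
              * (\<Prod>i<m. \<Prod>j\<in>{i<..<m}. (x i - x j) ^ 4)
              * indicator ({..<m} \<rightarrow>\<^sub>E {0..1}) x
        \<partial>(\<Pi>\<^sub>M i\<in>{..<m}. lborel))
      = fact m * (\<Prod>i<2*m. \<Prod>j\<in>{i<..<2*m}.
           let y = (\<lambda>k. real (2*m) + real (lam ! k) - real (k+1)) in (y i - y j) / (y i + y j))"
    by (simp add: Let_def)
next
  fix lam assume lam: "is_partition (2*m+1) lam"
  define z where "z x k = (if k < 2*m then x (k div 2) else 1)" for x :: "nat \<Rightarrow> real" and k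
  have N: "(2*m+1) div 2 = m" "odd (2*m+1)" by simp_all
  \<comment> \<open>The lone last index \<open>2*m\<close> carries the argument 1 and yields the
    factors (x_i - 1)^2.\<close>
  have "cross_prod (2*m+1) (z x)
      = (\<Prod>i<m. \<Prod>j\<in>{i<..<m}. (x i - x j) ^ 4) * (\<Prod>i<m. (1 - x i) ^ 2)" for x
    by (subst cross_prod_paired[where x = x]) (simp_all add: z_def power2_commute[of 1])
  with integral_schur_paired[OF lam, of z "\<lambda>k. real (2*m+1) + real (lam ! k) - real (k+1)"]
  have "(\<integral>x. schur (2*m+1) lam (z x)
              * ((\<Prod>i<m. \<Prod>j\<in>{i<..<m}. (x i - x j) ^ 4) * (\<Prod>i<m. (1 - x i) ^ 2))
              * indicator ({..<m} \<rightarrow>\<^sub>E {0..1}) x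
        \<partial>(\<Pi>\<^sub>M i\<in>{..<m}. lborel))
      = fact m * (\<Prod>i<2*m+1. \<Prod>j\<in>{i<..<2*m+1}.
           let y = (\<lambda>k. real (2*m+1) + real (lam ! k) - real (k+1)) in (y i - y j) / (y i + y j))"
    unfolding N Let_def by (simp add: z_def)
  then show "(\<integral>x. schur (2*m+1) lam (\<lambda>k. if k < 2*m then x (k div 2) else 1)
              * (\<Prod>i<m. \<Prod>j\<in>{i<..<m}. (x i - x j) ^ 4)
              * (\<Prod>i<m. (1 - x i) ^ 2)
              * indicator ({..<m} \<rightarrow>\<^sub>E {0..1}) x
        \<partial>(\<Pi>\<^sub>M i\<in>{..<m}. lborel))
      = fact m * (\<Prod>i<2*m+1. \<Prod>j\<in>{i<..<2*m+1}.
           let y = (\<lambda>k. real (2*m+1) + real (lam ! k) - real (k+1)) in (y i - y j) / (y i + y j))"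
    by (simp only: z_def[abs_def] mult.assoc)
qed

end
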